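(* For every $n\ge1$, the algebra $\mathbb{C}_2^{\,n}$ (with componentwise operations) equipped with the idempotent norm $|||\cdot|||_{ID}$ is a Banach algebra, and $\mathbb{C}_2^{\,n}$ equipped with the idempotent inner product $\langle\langle\cdot,\cdot\rangle\rangle_{ID}$ is a Hilbert space.
   Context: $\mathbb{C}_0$ is the set of real numbers and $\mathbb{C}_1=\{a+i_1b: a,b\in\mathbb{C}_0\}$ the set of complex numbers, with complex conjugation written $\overline{\,\cdot\,}$. $\mathbb{C}_2$ is the set of bicomplex numbers $\xi=x_1+i_1x_2+i_2x_3+i_1i_2x_4$ with $x_1,\dots,x_4$ real, where $i_1^2=i_2^2=-1$ and $i_1i_2=i_2i_1$. Equivalently $\xi=z_1+i_2z_2$ with $z_1=x_1+i_1x_2$, $z_2=x_3+i_1x_4\in\mathbb{C}_1$; for $\alpha\in\mathbb{C}_1$, $\alpha\xi=\alpha z_1+i_2\alpha z_2$, and $(z_1+i_2z_2)\times(w_1+i_2w_2)=(z_1w_1-z_2w_2)+i_2(z_1w_2+z_2w_1)$. The idempotent components of $\xi$ are $\xi^-=z_1-i_1z_2$ and $\xi^+=z_1+i_1z_2$ in $\mathbb{C}_1$. $\mathbb{C}_2^{\,n}$ is the set of $n$-tuples of bicomplex numbers; addition, multiplication by scalars in $\mathbb{C}_1$, and the product $P\times Q=(\xi_1\times\eta_1,\dots,\xi_n\times\eta_n)$ are componentwise, making it an algebra over $\mathbb{C}_1$. For $P=(\xi_1,\dots,\xi_n)$, $Q=(\eta_1,\dots,\eta_n)$, the idempotent inner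 product is $\langle\langle P,Q\rangle\rangle_{ID}=\sum_{k=1}^n\left((\xi_k)^-\,\overline{(\eta_k)^-}+(\xi_k)^+\,\overline{(\eta_k)^+}\right)$ and the idempotent norm is $|||P|||_{ID}=\sqrt{\langle\langle P,P\rangle\rangle_{ID}}$. A Banach algebra is an algebra with a complete norm satisfying $\|ab\|\le\|a\|\|b\|$ (no condition on the norm of the unit is imposed). *)

theory Defs
  imports "HOL-Analysis.Analysis"
begin

section \<open>Banach algebras and Hilbert spaces over the complex numbers\<close>

text \<open>The corresponding type classes of the library have scalar field \<^typ>\<open>real\<close>. Here the
  scalars are complex, the carrier is a whole type, and completeness is that of the metric induced
  by the norm.\<close>

locale complex_algebra = vector_space scale
  for scale :: "complex \<Rightarrow> 'a::ab_group_add \<Rightarrow> 'a" +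
  fixes mult :: "'a \<Rightarrow> 'a \<Rightarrow> 'a"
  assumes mult_assoc: "mult (mult x y) z = mult x (mult y z)"
    and mult_add_left: "mult (x + y) z = mult x z + mult y z"
    and mult_add_right: "mult x (y + z) = mult x y + mult x z"
    and mult_scale_left: "mult (scale c x) y = scale c (mult x y)"
    and mult_scale_right: "mult x (scale c y) = scale c (mult x y)"

locale complex_normed_space = vector_space scale
  for scale :: "complex \<Rightarrow> 'a::ab_group_add \<Rightarrow> 'a" +
  fixes nrm :: "'a \<Rightarrow> real"
  assumes nrm_nonneg: "0 \<le> nrm x"
    and nrm_eq_0_iff: "nrm x = 0 \<longleftrightarrow> x = 0"
    and nrm_scale: "nrm (scale c x) = cmod c * nrm x"
    and nrm_triangle: "nrm (x + y) \<le> nrm x + nrm y"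

text \<open>No unit is required, so there is no condition on the norm of a unit either.\<close>

locale complex_banach_algebra =
  complex_algebra scale mult + complex_normed_space scale nrm
  for scale :: "complex \<Rightarrow> 'a::ab_group_add \<Rightarrow> 'a"
    and mult :: "'a \<Rightarrow> 'a \<Rightarrow> 'a"
    and nrm :: "'a \<Rightarrow> real" +
  assumes nrm_mult_le: "nrm (mult x y) \<le> nrm x * nrm y"
    and nrm_complete: "Metric_space.mcomplete UNIV (\<lambda>x y. nrm (x - y))"

text \<open>Inner products are linear in the first argument. Conjugate symmetry makes \<open>ip x x\<close> real.\<close>

locale complex_inner_product_space = vector_space scale
  for scale :: "complex \<Rightarrow> 'a::ab_group_add \<Rightarrow> 'a" +
  fixes ip :: "'a \<Rightarrow> 'a \<Rightarrow> complex"
  assumes ip_add_left: "ip (x + y) z = ip x z + ip y z"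
    and ip_scale_left: "ip (scale c x) y = c * ip x y"
    and ip_cnj_commute: "ip x y = cnj (ip y x)"
    and ip_self_nonneg: "0 \<le> Re (ip x x)"
    and ip_self_eq_0_iff: "ip x x = 0 \<longleftrightarrow> x = 0"

locale complex_hilbert_space = complex_inner_product_space scale ip
  for scale :: "complex \<Rightarrow> 'a::ab_group_add \<Rightarrow> 'a"
    and ip :: "'a \<Rightarrow> 'a \<Rightarrow> complex" +
  assumes ip_complete:
    "Metric_space.mcomplete UNIV (\<lambda>x y. sqrt (Re (ip (x - y) (x - y))))"


section \<open>Bicomplex numbers\<close>

text \<open>\<open>Bicomplex z w\<close> stands for \<open>z + i\<^sub>2 w\<close>, with \<open>i\<^sub>1\<close> the imaginary unit \<open>\<i>\<close> of
  \<^typ>\<open>complex\<close>.\<close>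

datatype bicomplex = Bicomplex (bc_fst: complex) (bc_snd: complex)

instantiation bicomplex :: comm_ring_1
begin

definition "0 = Bicomplex 0 0"
definition "1 = Bicomplex 1 0"
definition "x + y = Bicomplex (bc_fst x + bc_fst y) (bc_snd x + bc_snd y)"
definition "- x = Bicomplex (- bc_fst x) (- bc_snd x)"
definition "x - y = Bicomplex (bc_fst x - bc_fst y) (bc_snd x - bc_snd y)"
definition "x * y = Bicomplex (bc_fst x * bc_fst y - bc_snd x * bc_snd y)
                              (bc_fst x * bc_snd y + bc_snd x * bc_fst y)"

instance
  by standard
    (simp_all add: zero_bicomplex_def one_bicomplex_def plus_bicomplex_def uminus_bicomplex_def
      minus_bicomplex_def times_bicomplex_def algebra_simps)

end

definition bc_scale :: "complex \<Rightarrow> bicomplex \<Rightarrow> bicomplex" where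
  "bc_scale a x = Bicomplex (a * bc_fst x) (a * bc_snd x)"

definition id_minus :: "bicomplex \<Rightarrow> complex" where
  "id_minus x = bc_fst x - \<i> * bc_snd x"

definition id_plus :: "bicomplex \<Rightarrow> complex" where
  "id_plus x = bc_fst x + \<i> * bc_snd x"


section \<open>Tuples of bicomplex numbers\<close>

text \<open>The space of \<open>n\<close>-tuples is \<^typ>\<open>bicomplex ^ 'n\<close> with \<open>n = CARD('n)\<close>. The library's
  addition and multiplication \<open>(*)\<close> on this type are the componentwise ones.\<close>

definition bcn_scale :: "complex \<Rightarrow> bicomplex ^ 'n \<Rightarrow> bicomplex ^ 'n" where
  "bcn_scale a P = (\<chi> k. bc_scale a (P $ k))"

definition id_inner :: "bicomplex ^ 'n \<Rightarrow> bicomplex ^ 'n \<Rightarrow> complex" where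
  "id_inner P Q = (\<Sum>k\<in>UNIV. id_minus (P $ k) * cnj (id_minus (Q $ k))
                           + id_plus (P $ k) * cnj (id_plus (Q $ k)))"

text \<open>\<open>id_inner P P\<close> is a sum of terms \<open>z * cnj z\<close>, hence a nonnegative real; \<^const>\<open>Re\<close> only
  changes its type.\<close>

definition id_norm :: "bicomplex ^ 'n \<Rightarrow> real" where
  "id_norm P = sqrt (Re (id_inner P P))"

end

theory Submission
  imports Defs
begin

text \<open>
  The idempotent components turn bicomplex numbers into pairs of complex numbers: the map
  \<open>\<xi> \<mapsto> (\<xi>\<^sup>-, \<xi>\<^sup>+)\<close> is a \<open>\<complex>\<close>-linear bijection onto \<open>\<complex> \<times> \<complex>\<close> and carries the bicomplex product
  to the product in each component. Applied in every coordinate (\<open>id_split\<close>), it identifies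
  \<^typ>\<open>bicomplex ^ 'n\<close> with \<^typ>\<open>(complex \<times> complex) ^ 'n\<close>, in such a way that the idempotent
  norm becomes the Euclidean norm (\<open>norm_id_split\<close>). Definiteness, the triangle inequality and
  completeness are thereby inherited from a finite-dimensional Euclidean space; completeness needs
  that \<open>id_split\<close> is onto, so that a limit has a preimage.

  Since products are formed component by component, the norm is submultiplicative for an elementary
  reason: no component of \<open>Q\<close> exceeds \<open>|||Q|||\<close> in modulus, so multiplying by \<open>Q\<close> enlarges each
  component of \<open>P\<close> by at most this factor. Finally, \<open>\<langle>\<langle>P, P\<rangle>\<rangle>\<close> is the real number \<open>|||P|||\<^sup>2\<close>
  (\<open>id_inner_self_norm\<close>), so the inner product takes its definiteness and its completeness from the
  norm.
\<close>

lemma id_minus_add: "id_minus (x + y) = id_minus x + id_minus y"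
  and id_plus_add: "id_plus (x + y) = id_plus x + id_plus y"
  and id_minus_diff: "id_minus (x - y) = id_minus x - id_minus y"
  and id_plus_diff: "id_plus (x - y) = id_plus x - id_plus y"
  and id_minus_scale: "id_minus (bc_scale c x) = c * id_minus x"
  and id_plus_scale: "id_plus (bc_scale c x) = c * id_plus x"
  by (simp_all add: id_minus_def id_plus_def plus_bicomplex_def minus_bicomplex_def
      bc_scale_def algebra_simps)

lemma id_minus_mult: "id_minus (x * y) = id_minus x * id_minus y"
  and id_plus_mult: "id_plus (x * y) = id_plus x * id_plus y"
  by (simp_all add: id_minus_def id_plus_def times_bicomplex_def algebra_simps)

lemmas id_component_simps =
  id_minus_add id_plus_add id_minus_diff id_plus_diff id_minus_scale id_plus_scale
  id_minus_mult id_plus_mult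

text \<open>The components determine \<open>z + i\<^sub>2 w\<close>, because \<open>z\<close> is half their sum and \<open>\<i> * w\<close> half their
  difference.\<close>

lemma bicomplex_eqI_id_components:
  assumes "id_minus x = id_minus y" "id_plus x = id_plus y"
  shows "x = y"
proof -
  have "id_minus x + id_plus x = id_minus y + id_plus y"
    "id_plus x - id_minus x = id_plus y - id_minus y"
    using assms by simp_all
  then have "bc_fst x = bc_fst y" "bc_snd x = bc_snd y"
    by (simp_all add: id_minus_def id_plus_def)
  then show ?thesis
    by (simp add: bicomplex.expand)
qed

definition of_id_components :: "complex \<Rightarrow> complex \<Rightarrow> bicomplex" where
  "of_id_components u v = Bicomplex ((u + v) / 2) (\<i> * (u - v) / 2)"

lemma id_minus_of_id_components [simp]: "id_minus (of_id_components u v) = u"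
  and id_plus_of_id_components [simp]: "id_plus (of_id_components u v) = v"
  by (simp_all add: of_id_components_def id_minus_def id_plus_def field_simps)

definition id_split :: "bicomplex ^ 'n \<Rightarrow> (complex \<times> complex) ^ 'n" where
  "id_split P = (\<chi> k. (id_minus (P $ k), id_plus (P $ k)))"

lemma id_split_add: "id_split (P + Q) = id_split P + id_split Q"
  and id_split_diff: "id_split (P - Q) = id_split P - id_split Q"
  by (simp_all add: id_split_def vec_eq_iff id_component_simps)

lemma id_split_0 [simp]: "id_split 0 = 0"
  using id_split_diff[of 0 0] by simp

lemma inj_id_split: "inj id_split"
  by (rule injI) (auto simp: id_split_def vec_eq_iff intro: bicomplex_eqI_id_components)

lemma surj_id_split: "surj id_split"
proof (rule surjI)
  show "id_split (\<chi> k. of_id_components (fst (R $ k)) (snd (R $ k))) = R"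
    for R :: "(complex \<times> complex) ^ 'n"
    by (simp add: id_split_def vec_eq_iff)
qed

lemma id_inner_self:
  "id_inner P P
    = of_real (\<Sum>k\<in>UNIV. (cmod (id_minus (P $ k)))\<^sup>2 + (cmod (id_plus (P $ k)))\<^sup>2)"
  unfolding id_inner_def by (simp add: complex_norm_square del: of_real_power)

lemma id_norm_eq:
  "id_norm P = sqrt (\<Sum>k\<in>UNIV. (cmod (id_minus (P $ k)))\<^sup>2 + (cmod (id_plus (P $ k)))\<^sup>2)"
  by (simp only: id_norm_def id_inner_self Re_complex_of_real)

lemma norm_id_split: "norm (id_split P) = id_norm P"
  by (simp add: id_norm_eq norm_vec_def L2_set_def id_split_def norm_prod_def)

lemma id_inner_self_norm: "id_inner P P = of_real ((id_norm P)\<^sup>2)"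
  by (simp only: id_inner_self id_norm_eq) (simp add: sum_nonneg)

lemma id_norm_nonneg: "0 \<le> id_norm P"
  by (simp flip: norm_id_split)

lemma id_norm_eq_0_iff: "id_norm P = 0 \<longleftrightarrow> P = 0"
  using inj_eq[OF inj_id_split, of P 0] by (simp flip: norm_id_split)

lemma id_norm_triangle: "id_norm (P + Q) \<le> id_norm P + id_norm Q"
  by (simp add: id_split_add norm_triangle_ineq flip: norm_id_split)

lemma id_norm_scale: "id_norm (bcn_scale c P) = cmod c * id_norm P"
  by (simp add: id_norm_eq bcn_scale_def id_component_simps norm_mult power_mult_distrib
      real_sqrt_mult flip: distrib_left sum_distrib_left)

lemma mcomplete_id_norm:
  "Metric_space.mcomplete (UNIV :: (bicomplex ^ 'n) set) (\<lambda>P Q. id_norm (P - Q))"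
proof -
  have d: "id_norm (P - Q) = dist (id_split P) (id_split Q)" for P Q :: "bicomplex ^ 'n"
    by (simp add: dist_norm id_split_diff flip: norm_id_split)
  interpret Metric_space "UNIV :: (bicomplex ^ 'n) set" "\<lambda>P Q. id_norm (P - Q)"
    by unfold_locales (auto simp: d dist_commute dist_triangle inj_eq[OF inj_id_split])
  show ?thesis
    unfolding mcomplete_def
  proof (intro allI impI)
    fix \<sigma> :: "nat \<Rightarrow> bicomplex ^ 'n"
    assume "MCauchy \<sigma>"
    then have "Cauchy (\<lambda>n. id_split (\<sigma> n))"
      unfolding MCauchy_def Cauchy_def by (simp add: d)
    then obtain R where "(\<lambda>n. id_split (\<sigma> n)) \<longlonglongrightarrow> R"
      by (auto simp: Cauchy_convergent_iff convergent_def)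
    moreover obtain P where "R = id_split P"
      using surj_id_split by (rule surjE)
    ultimately have "limitin mtopology \<sigma> P sequentially"
      unfolding limit_metric_sequentially tendsto_iff eventually_sequentially by (simp add: d)
    then show "\<exists>P. limitin mtopology \<sigma> P sequentially" ..
  qed
qed

lemma cmod_id_components_le_id_norm:
  shows "cmod (id_minus (P $ k)) \<le> id_norm P" and "cmod (id_plus (P $ k)) \<le> id_norm P"
proof -
  have "norm (id_minus (P $ k), id_plus (P $ k)) \<le> id_norm P"
    using Finite_Cartesian_Product.norm_nth_le[of "id_split P" k] by (simp only: norm_id_split) (simp add: id_split_def)
  then show "cmod (id_minus (P $ k)) \<le> id_norm P" and "cmod (id_plus (P $ k)) \<le> id_norm P"
    using norm_fst_le[of "id_minus (P $ k)" "id_plus (P $ k)"]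
      norm_snd_le[of "id_plus (P $ k)" "id_minus (P $ k)"] by linarith+
qed

text \<open>The factor \<open>id_norm Q\<close> bounds both components of \<open>Q\<close> in every coordinate, so it leaves the
  sum as a constant.\<close>

lemma id_norm_mult_le: "id_norm (P * Q) \<le> id_norm P * id_norm Q"
proof -
  let ?p = "\<lambda>k. cmod (id_minus (P $ k))" and ?p' = "\<lambda>k. cmod (id_plus (P $ k))"
  have "(\<Sum>k\<in>UNIV. (cmod (id_minus ((P * Q) $ k)))\<^sup>2 + (cmod (id_plus ((P * Q) $ k)))\<^sup>2)
      \<le> (\<Sum>k\<in>UNIV. (?p k * id_norm Q)\<^sup>2 + (?p' k * id_norm Q)\<^sup>2)"
    by (intro sum_mono add_mono power_mono)
      (simp_all add: id_component_simps norm_mult mult_left_mono cmod_id_components_le_id_norm)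
  also have "\<dots> = (\<Sum>k\<in>UNIV. (?p k)\<^sup>2 + (?p' k)\<^sup>2) * (id_norm Q)\<^sup>2"
    by (simp add: power_mult_distrib sum_distrib_right distrib_right)
  finally have "id_norm (P * Q) \<le> sqrt ((\<Sum>k\<in>UNIV. (?p k)\<^sup>2 + (?p' k)\<^sup>2) * (id_norm Q)\<^sup>2)"
    by (simp only: id_norm_eq[of "P * Q"] real_sqrt_le_mono)
  also have "\<dots> = id_norm P * id_norm Q"
    by (simp add: real_sqrt_mult id_norm_nonneg id_norm_eq[of P])
  finally show ?thesis .
qed

lemma vector_space_bcn_scale:
  "vector_space (bcn_scale :: complex \<Rightarrow> bicomplex ^ 'n \<Rightarrow> bicomplex ^ 'n)"
  by unfold_locales
    (simp_all add: bcn_scale_def bc_scale_def plus_bicomplex_def vec_eq_iff algebra_simps)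

theorem corollary2p30:
  shows "complex_banach_algebra
           (bcn_scale :: complex \<Rightarrow> bicomplex ^ 'n \<Rightarrow> bicomplex ^ 'n) (*) id_norm
       \<and> complex_hilbert_space
           (bcn_scale :: complex \<Rightarrow> bicomplex ^ 'n \<Rightarrow> bicomplex ^ 'n) id_inner"
proof
  interpret vector_space "bcn_scale :: complex \<Rightarrow> bicomplex ^ 'n \<Rightarrow> bicomplex ^ 'n"
    by (rule vector_space_bcn_scale)
  show "complex_banach_algebra
      (bcn_scale :: complex \<Rightarrow> bicomplex ^ 'n \<Rightarrow> bicomplex ^ 'n) (*) id_norm"
  proof unfold_locales
    fix x y z :: "bicomplex ^ 'n" and c :: complex
    show "x * y * z = x * (y * z)" "(x + y) * z = x * z + y * z" "x * (y + z) = x * y + x * z"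
      by (simp_all add: algebra_simps)
    show "bcn_scale c x * y = bcn_scale c (x * y)" "x * bcn_scale c y = bcn_scale c (x * y)"
      by (simp_all add: bcn_scale_def bc_scale_def times_bicomplex_def vec_eq_iff algebra_simps)
  qed (fact id_norm_nonneg id_norm_eq_0_iff id_norm_scale id_norm_triangle id_norm_mult_le
      mcomplete_id_norm)+
  show "complex_hilbert_space
      (bcn_scale :: complex \<Rightarrow> bicomplex ^ 'n \<Rightarrow> bicomplex ^ 'n) id_inner"
  proof unfold_locales
    fix x y z :: "bicomplex ^ 'n" and c :: complex
    show "id_inner (x + y) z = id_inner x z + id_inner y z"
      by (simp add: id_inner_def id_component_simps algebra_simps sum.distrib)
    show "id_inner (bcn_scale c x) y = c * id_inner x y"
      by (simp add: id_inner_def bcn_scale_def id_component_simps sum_distrib_left algebra_simps)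
    show "id_inner x y = cnj (id_inner y x)"
      by (simp add: id_inner_def mult.commute)
    show "0 \<le> Re (id_inner x x)" "id_inner x x = 0 \<longleftrightarrow> x = 0"
      by (simp_all add: id_inner_self_norm id_norm_eq_0_iff del: of_real_power)
    show "Metric_space.mcomplete (UNIV :: (bicomplex ^ 'n) set)
        (\<lambda>x y. sqrt (Re (id_inner (x - y) (x - y))))"
      using mcomplete_id_norm by (simp only: id_norm_def)
  qed
qed

end
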